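(* Let $n_1<n_2<\cdots$ denote all the indices $n$ with $\Delta_{n-1}\Delta_n>0$ (if any exist). Suppose there exist infinitely many $i$ such that $n_{i-1}+4\le n_i$. Then $\lim_{n\to\infty}\Delta_n=0$.
   Context: For real $x$ let $[x]$ be the greatest integer $\le x$ and $\{x\}=x-[x]$. Let $(\alpha_0,\beta_0)\in\mathbf{R}^2$ with $0\le\alpha_0\le\beta_0$ and $1\le\beta_0$. The Jacobi-Perron algorithm (dimension 2) defines, for $n\ge1$, $\alpha_n=\{\beta_{n-1}\}/\{\alpha_{n-1}\}$ and $\beta_n=1/\{\alpha_{n-1}\}$; if $\{\alpha_m\}=0$ for some $m$, the expansion stops there. Put $a_n=[\alpha_n]$, $b_n=[\beta_n]$ for $n\ge0$. Define $(r_{-2},r_{-1},r_0)=(0,0,1)$, $(p_{-2},p_{-1},p_0)=(1,0,a_0)$, $(q_{-2},q_{-1},q_0)=(0,1,b_0)$, and for $n\ge1$: $r_n=r_{n-1}b_n+r_{n-2}a_n+r_{n-3}$, $p_n=p_{n-1}b_n+p_{n-2}a_n+p_{n-3}$, $q_n=q_{n-1}b_n+q_{n-2}a_n+q_{n-3}$. Set $\Delta_n=p_n-\alpha_0 r_n$ for $n\ge0$. *)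

theory Defs
  imports Complex_Main "HOL-Library.Infinite_Set"
begin

primrec jp :: "real \<Rightarrow> real \<Rightarrow> nat \<Rightarrow> real \<times> real" where
  "jp \<alpha>0 \<beta>0 0 = (\<alpha>0, \<beta>0)"
| "jp \<alpha>0 \<beta>0 (Suc n) =
     (frac (snd (jp \<alpha>0 \<beta>0 n)) / frac (fst (jp \<alpha>0 \<beta>0 n)), 1 / frac (fst (jp \<alpha>0 \<beta>0 n)))"

definition jp_alpha :: "real \<Rightarrow> real \<Rightarrow> nat \<Rightarrow> real" where
  "jp_alpha \<alpha>0 \<beta>0 n = fst (jp \<alpha>0 \<beta>0 n)"

definition jp_beta :: "real \<Rightarrow> real \<Rightarrow> nat \<Rightarrow> real" where
  "jp_beta \<alpha>0 \<beta>0 n = snd (jp \<alpha>0 \<beta>0 n)"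

text \<open>The expansion stops at the first \<open>m\<close> with \<open>frac (jp_alpha \<alpha>0 \<beta>0 m) = 0\<close>.  Past that point the
  total function \<open>jp\<close> continues with meaningless values (division by zero), so the terms of index
  \<open>n\<close> belong to the expansion only if \<open>jp_reaches \<alpha>0 \<beta>0 n\<close>.\<close>

definition jp_reaches :: "real \<Rightarrow> real \<Rightarrow> nat \<Rightarrow> bool" where
  "jp_reaches \<alpha>0 \<beta>0 n \<longleftrightarrow> (\<forall>m<n. frac (jp_alpha \<alpha>0 \<beta>0 m) \<noteq> 0)"

definition jp_a :: "real \<Rightarrow> real \<Rightarrow> nat \<Rightarrow> int" where
  "jp_a \<alpha>0 \<beta>0 n = \<lfloor>jp_alpha \<alpha>0 \<beta>0 n\<rfloor>"

definition jp_b :: "real \<Rightarrow> real \<Rightarrow> nat \<Rightarrow> int" where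
  "jp_b \<alpha>0 \<beta>0 n = \<lfloor>jp_beta \<alpha>0 \<beta>0 n\<rfloor>"

text \<open>The recurrence \<open>x\<^sub>n = x\<^sub>n\<^sub>-\<^sub>1 b\<^sub>n + x\<^sub>n\<^sub>-\<^sub>2 a\<^sub>n + x\<^sub>n\<^sub>-\<^sub>3\<close> for \<open>n \<ge> 1\<close>, with the index shifted by two:
  \<open>jp_rec a b u v w k\<close> is \<open>x\<^sub>k\<^sub>-\<^sub>2\<close>, where \<open>(u, v, w)\<close> are the values at \<open>-2, -1, 0\<close>.\<close>

fun jp_rec :: "(nat \<Rightarrow> int) \<Rightarrow> (nat \<Rightarrow> int) \<Rightarrow> int \<Rightarrow> int \<Rightarrow> int \<Rightarrow> nat \<Rightarrow> int" where
  "jp_rec a b u v w 0 = u"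
| "jp_rec a b u v w (Suc 0) = v"
| "jp_rec a b u v w (Suc (Suc 0)) = w"
| "jp_rec a b u v w (Suc (Suc (Suc n))) =
     jp_rec a b u v w (Suc (Suc n)) * b (Suc n) + jp_rec a b u v w (Suc n) * a (Suc n)
     + jp_rec a b u v w n"

definition jp_r :: "real \<Rightarrow> real \<Rightarrow> nat \<Rightarrow> int" where
  "jp_r \<alpha>0 \<beta>0 n = jp_rec (jp_a \<alpha>0 \<beta>0) (jp_b \<alpha>0 \<beta>0) 0 0 1 (n + 2)"

definition jp_p :: "real \<Rightarrow> real \<Rightarrow> nat \<Rightarrow> int" where
  "jp_p \<alpha>0 \<beta>0 n = jp_rec (jp_a \<alpha>0 \<beta>0) (jp_b \<alpha>0 \<beta>0) 1 0 (jp_a \<alpha>0 \<beta>0 0) (n + 2)"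

definition jp_Delta :: "real \<Rightarrow> real \<Rightarrow> nat \<Rightarrow> real" where
  "jp_Delta \<alpha>0 \<beta>0 n = of_int (jp_p \<alpha>0 \<beta>0 n) - \<alpha>0 * of_int (jp_r \<alpha>0 \<beta>0 n)"

definition same_sign_indices :: "real \<Rightarrow> real \<Rightarrow> nat set" where
  "same_sign_indices \<alpha>0 \<beta>0 =
     {n. 1 \<le> n \<and> jp_reaches \<alpha>0 \<beta>0 n \<and> jp_Delta \<alpha>0 \<beta>0 (n - 1) * jp_Delta \<alpha>0 \<beta>0 n > 0}"

end

theory Submission
  imports Defs
begin

text \<open>
  Once the expansion is known to be infinite, the residuals \<open>\<Delta>\<^sub>n\<close> satisfy two recurrences at once.
  One is inherited from \<open>p\<close> and \<open>r\<close> and has the digits as coefficients,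
  \<open>\<Delta>\<^sub>n = b\<^sub>n \<Delta>\<^sub>n\<^sub>-\<^sub>1 + a\<^sub>n \<Delta>\<^sub>n\<^sub>-\<^sub>2 + \<Delta>\<^sub>n\<^sub>-\<^sub>3\<close>.  The other comes from the identity
  \<open>\<beta>\<^sub>n \<Delta>\<^sub>n\<^sub>-\<^sub>1 + \<alpha>\<^sub>n \<Delta>\<^sub>n\<^sub>-\<^sub>2 + \<Delta>\<^sub>n\<^sub>-\<^sub>3 = 0\<close>; subtracting it leaves the fractional parts,
  \<open>\<Delta>\<^sub>n = - {\<beta>\<^sub>n} \<Delta>\<^sub>n\<^sub>-\<^sub>1 - {\<alpha>\<^sub>n} \<Delta>\<^sub>n\<^sub>-\<^sub>2\<close>.

  Together they make the largest of three consecutive values \<open>\<bar>\<Delta>\<^sub>n\<bar>\<close>, called the height below,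
  nonincreasing: if the last two residuals have opposite signs, the fractional recurrence bounds
  the next one by the larger of them, and if they have equal signs, the next one has the opposite
  sign and the digit recurrence bounds it by the residual three steps back.  So the height has a
  limit, and the point is to show that it shrinks by a fixed factor infinitely often.

  This happens after a pair \<open>\<Delta>\<^sub>m\<^sub>-\<^sub>1, \<Delta>\<^sub>m > 0\<close> that is followed by alternating signs
  \<open>\<Delta>\<^sub>m\<^sub>+\<^sub>1 < 0 < \<Delta>\<^sub>m\<^sub>+\<^sub>2\<close>, \<open>\<Delta>\<^sub>m\<^sub>+\<^sub>3 \<le> 0\<close>.  Alternation makes \<open>\<bar>\<Delta>\<^sub>m\<^sub>+\<^sub>1\<bar>\<close> the height from there on, while
  \<open>\<bar>\<Delta>\<^sub>m\<^sub>+\<^sub>1\<bar> \<le> \<bar>\<Delta>\<^sub>m\<^sub>-\<^sub>2\<bar> - b \<bar>\<Delta>\<^sub>m\<bar>\<close>.  If the height hardly drops, \<open>\<Delta>\<^sub>m\<close> must be tiny.  Then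
  \<open>\<Delta>\<^sub>m\<^sub>+\<^sub>2 + b \<bar>\<Delta>\<^sub>m\<^sub>+\<^sub>1\<bar> = a \<Delta>\<^sub>m + \<Delta>\<^sub>m\<^sub>-\<^sub>1\<close> makes \<open>\<Delta>\<^sub>m\<^sub>+\<^sub>2\<close> tiny as well, hence also \<open>\<Delta>\<^sub>m\<^sub>+\<^sub>3\<close> and
  \<open>\<Delta>\<^sub>m\<^sub>+\<^sub>4\<close>, so that the height has dropped after all (\<open>height_contracts\<close>).

  A gap of length four in the set of same-sign indices produces exactly this pattern, except that
  \<open>\<Delta>\<^sub>m\<^sub>+\<^sub>2\<close> could vanish.  But \<open>\<Delta>\<^sub>k = 0\<close> makes \<open>\<alpha>\<^sub>0\<close> rational with denominator \<open>r\<^sub>k\<close>, so that all nonzero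
  residuals are at least \<open>1 / r\<^sub>k\<close> in absolute value; the estimate
  of \<open>\<bar>\<Delta>\<^sub>m\<bar>\<close> by the drop of the height (\<open>middle_le_height_drop\<close>), which tends to \<open>0\<close> along the
  gaps, excludes this.
\<close>

section \<open>Real sequences with a digit recurrence and a fractional recurrence\<close>

locale residual_recurrence =
  fixes x a b c d :: "nat \<Rightarrow> real"
  assumes digit_step: "x (n + 3) = b n * x (n + 2) + a n * x (n + 1) + x n"
    and frac_step: "x (n + 3) = - (c n * x (n + 2)) - d n * x (n + 1)"
    and a_nonneg: "0 \<le> a n"
    and a_le_b: "a n \<le> b n"
    and b_ge_1: "1 \<le> b n"
    and c_nonneg: "0 \<le> c n"
    and c_le_1: "c n \<le> 1"
    and d_pos: "0 < d n"
    and d_le_1: "d n \<le> 1"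
begin

definition height :: "nat \<Rightarrow> real" where
  "height n = max \<bar>x n\<bar> (max \<bar>x (n + 1)\<bar> \<bar>x (n + 2)\<bar>)"

text \<open>The pattern produced by a same-sign index \<open>k + 2\<close> that is followed by a gap of length four.\<close>

definition long_gap :: "nat \<Rightarrow> bool" where
  "long_gap k \<longleftrightarrow> x (k + 1) * x (k + 2) > 0 \<and> x (k + 3) * x (k + 4) \<le> 0 \<and> x (k + 4) * x (k + 5) \<le> 0"

text \<open>The axioms are invariant under a change of sign, so estimates need only be shown for one
  choice of signs.\<close>

lemma uminus_residual_recurrence: "residual_recurrence (\<lambda>n. - x n) a b c d"
proof
  fix n
  show "- x (n + 3) = b n * - x (n + 2) + a n * - x (n + 1) + - x n"
    using digit_step[of n] by simp
  show "- x (n + 3) = - (c n * - x (n + 2)) - d n * - x (n + 1)"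
    using frac_step[of n] by simp
qed (use a_nonneg a_le_b b_ge_1 c_nonneg c_le_1 d_pos d_le_1 in auto)

lemma height_bounds: "\<bar>x n\<bar> \<le> height n" "\<bar>x (n + 1)\<bar> \<le> height n" "\<bar>x (n + 2)\<bar> \<le> height n"
  by (auto simp: height_def)

lemma height_nonneg: "0 \<le> height n"
  using height_bounds(1)[of n] by linarith

text \<open>The digit recurrence controls the next value after two of equal sign, where the fractional
  recurrence alone would allow their sum; after two of opposite signs the terms of the fractional
  recurrence partly cancel.\<close>

lemma step_same_sign:
  assumes "0 \<le> x (n + 1)" "0 \<le> x (n + 2)"
  shows "x (n + 3) \<le> 0" "x n + x (n + 2) \<le> x (n + 3)"
proof -
  have "0 \<le> c n * x (n + 2)" "0 \<le> d n * x (n + 1)"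
    using assms c_nonneg[of n] d_pos[of n] by auto
  then show "x (n + 3) \<le> 0" using frac_step[of n] by linarith
  have "x (n + 2) \<le> b n * x (n + 2)" "0 \<le> a n * x (n + 1)"
    using assms b_ge_1[of n] a_nonneg[of n] mult_right_mono[of 1 "b n" "x (n + 2)"] by auto
  then show "x n + x (n + 2) \<le> x (n + 3)" using digit_step[of n] by linarith
qed

lemma step_opposite_sign:
  assumes "x (n + 1) \<le> 0" "0 \<le> x (n + 2)"
  shows "- x (n + 2) \<le> x (n + 3)" "x (n + 3) \<le> - x (n + 1)"
proof -
  have "0 \<le> c n * x (n + 2)" "c n * x (n + 2) \<le> x (n + 2)"
    using assms c_nonneg[of n] c_le_1[of n] by (auto intro: mult_left_le_one_le)
  moreover have "0 \<le> d n * - x (n + 1)" "d n * - x (n + 1) \<le> - x (n + 1)"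
    using assms d_pos[of n] d_le_1[of n] mult_left_le_one_le[of "- x (n + 1)" "d n"]
    by (auto simp: mult_nonneg_nonpos)
  ultimately show "- x (n + 2) \<le> x (n + 3)" "x (n + 3) \<le> - x (n + 1)"
    using frac_step[of n] by auto
qed

lemma abs_step_le_height_aux:
  assumes "0 \<le> x (n + 2)"
  shows "\<bar>x (n + 3)\<bar> \<le> height n"
proof (cases "0 \<le> x (n + 1)")
  case True
  then show ?thesis
    using step_same_sign[OF True assms] assms height_bounds[of n] by linarith
next
  case False
  then show ?thesis
    using step_opposite_sign[of n] assms height_bounds[of n] by linarith
qed

lemma height_uminus: "residual_recurrence.height (\<lambda>n. - x n) = height"
  using residual_recurrence.height_def[OF uminus_residual_recurrence]
  by (simp add: fun_eq_iff height_def)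

lemma long_gap_uminus: "residual_recurrence.long_gap (\<lambda>n. - x n) = long_gap"
  using residual_recurrence.long_gap_def[OF uminus_residual_recurrence]
  by (simp add: fun_eq_iff long_gap_def)

lemma abs_step_le_height: "\<bar>x (n + 3)\<bar> \<le> height n"
proof (cases "0 \<le> x (n + 2)")
  case True
  then show ?thesis by (rule abs_step_le_height_aux)
next
  case False
  then show ?thesis
    using residual_recurrence.abs_step_le_height_aux[OF uminus_residual_recurrence, of n]
    by (simp add: height_uminus)
qed

lemma antimono_height: "antimono height"
proof (rule antimonoI)
  have "height (Suc n) \<le> height n" for n
    using abs_step_le_height[of n] height_bounds[of n]
    by (simp add: height_def[of "Suc n"] numeral_eq_Suc)
  then show "height n \<le> height m" if "m \<le> n" for m n
    using that by (rule lift_Suc_antimono_le)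
qed

subsection \<open>Long gaps\<close>

text \<open>As long as the signs alternate, the two terms of the fractional recurrence have opposite
  signs, so the absolute values cannot grow and \<open>\<bar>x (k + 3)\<bar>\<close> remains the height.  If
  \<open>x (k + 4) = 0\<close>, the value \<open>x (k + 5)\<close> may be positive, but it is still bounded by
  \<open>\<bar>x (k + 3)\<bar>\<close>.\<close>

lemma long_gap_bounds_aux:
  assumes "long_gap k" "0 < x (k + 2)"
  shows "0 < x (k + 1)" "x (k + 3) < 0" "0 \<le> x (k + 4)" "x (k + 4) \<le> - x (k + 3)"
    "height (k + 3) = - x (k + 3)" "x k + x (k + 2) \<le> x (k + 3)"
    "x (k + 4) \<noteq> 0 \<Longrightarrow> x (k + 5) \<le> 0 \<and> - x (k + 4) \<le> x (k + 5)"
proof -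
  show x1: "0 < x (k + 1)"
    using assms by (simp add: long_gap_def zero_less_mult_iff)
  have "0 \<le> c k * x (k + 2)" "0 < d k * x (k + 1)"
    using assms x1 c_nonneg[of k] d_pos[of k] by auto
  then show x3: "x (k + 3) < 0" using frac_step[of k] by linarith
  show x4: "0 \<le> x (k + 4)"
    using assms x3 by (auto simp: long_gap_def mult_le_0_iff)
  have "0 \<le> d (k + 1) * x (k + 2)" using assms d_pos[of "k + 1"] by simp
  moreover have "c (k + 1) * - x (k + 3) \<le> - x (k + 3)"
    using x3 c_nonneg[of "k + 1"] c_le_1[of "k + 1"] by (intro mult_left_le_one_le) auto
  ultimately show x43: "x (k + 4) \<le> - x (k + 3)"
    using frac_step[of "k + 1"] by (simp add: numeral_eq_Suc)
  show "x k + x (k + 2) \<le> x (k + 3)"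
    using step_same_sign(2)[of k] x1 assms by simp
  have x5: "- x (k + 4) \<le> x (k + 5)" "x (k + 5) \<le> - x (k + 3)"
    using step_opposite_sign[of "k + 2"] x3 x4 by (auto simp: numeral_eq_Suc)
  show "height (k + 3) = - x (k + 3)"
    using x3 x4 x43 x5 by (simp add: height_def add.commute)
  show "x (k + 5) \<le> 0 \<and> - x (k + 4) \<le> x (k + 5)" if "x (k + 4) \<noteq> 0"
    using that x4 x5 assms by (auto simp: long_gap_def mult_le_0_iff)
qed

lemma middle_le_height_drop_aux:
  assumes "long_gap k" "0 < x (k + 2)"
  shows "x (k + 2) \<le> height k - height (k + 3)"
  using long_gap_bounds_aux[OF assms] height_bounds[of k] by linarith

text \<open>With \<open>e\<close> the drop of the height, \<open>x (k + 2) \<le> e\<close>.  The digit recurrence then forces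
  \<open>b \<le> 2\<close> (as \<open>e\<close> is small) and in turn \<open>x (k + 4) \<le> 3 e\<close>.  The fractional recurrence gives
  \<open>\<bar>x (k + 5)\<bar> \<le> 3 e\<close> and \<open>\<bar>x (k + 6)\<bar> \<le> 6 e\<close>, so that the new height is at most \<open>6 e\<close>.\<close>

lemma height_contracts_aux:
  assumes gap: "long_gap k" "0 < x (k + 2)" and "x (k + 4) \<noteq> 0"
  shows "7 * height (k + 4) \<le> 6 * height k"
proof (rule ccontr)
  assume large: "\<not> ?thesis"
  define w e where "w = height (k + 4)" and "e = height k - w"
  have e: "6 * e < w" using large by (simp add: w_def e_def)
  note gb = long_gap_bounds_aux[OF gap]
  have w3: "w \<le> - x (k + 3)"
    using antimonoD[OF antimono_height, of "k + 3" "k + 4"] gb(5) by (simp add: w_def)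
  have x2: "x (k + 2) \<le> e"
    using middle_le_height_drop_aux[OF gap] gb(5) w3 by (simp add: e_def)
  have x1: "x (k + 1) \<le> w + e"
    using height_bounds(2)[of k] by (simp add: e_def)
  define b' where "b' = b (k + 1)"
  have b': "1 \<le> b'" by (simp add: b'_def b_ge_1)
  have "x (k + 4) = b' * x (k + 3) + a (k + 1) * x (k + 2) + x (k + 1)"
    using digit_step[of "k + 1"] by (simp add: b'_def numeral_eq_Suc)
  moreover have "a (k + 1) * x (k + 2) \<le> b' * e"
    using a_le_b[of "k + 1"] a_nonneg[of "k + 1"] gap(2) x2 b'
    by (intro mult_mono) (auto simp: b'_def)
  moreover have "b' * w \<le> b' * - x (k + 3)"
    using w3 b' by (intro mult_left_mono) auto
  ultimately have x4: "x (k + 4) + b' * w \<le> b' * e + (w + e)"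
    using x1 by simp
  have "b' \<le> 2"
  proof (rule ccontr)
    assume "\<not> b' \<le> 2"
    \<comment> \<open>\<open>x4\<close> reads \<open>b' (w - e) \<le> w + e - x (k + 4)\<close>, while \<open>w + e \<le> 2 (w - e)\<close> as \<open>3 e \<le> w\<close>.\<close>
    then have "2 * (w - e) \<le> b' * (w - e)"
      using e gap(2) x2 by (intro mult_right_mono) auto
    then show False using x4 gb(3) e gap(2) x2 assms(3) by (simp add: algebra_simps)
  qed
  then have "b' * e \<le> 2 * e"
    using gap(2) x2 by (intro mult_right_mono) auto
  moreover have "1 * w \<le> b' * w"
    using b' e gap(2) x2 by (intro mult_right_mono) auto
  ultimately have x4': "x (k + 4) \<le> 3 * e" using x4 by linarith
  have x5: "x (k + 5) \<le> 0" "- x (k + 4) \<le> x (k + 5)" using gb(7)[OF assms(3)] by auto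
  have "\<bar>x (k + 6)\<bar> \<le> x (k + 4) - x (k + 5)"
  proof -
    have "0 \<le> - x (k + 5)" using x5 by simp
    then have "0 \<le> c (k + 3) * - x (k + 5)" "c (k + 3) * - x (k + 5) \<le> - x (k + 5)"
      using mult_nonneg_nonneg mult_left_le_one_le c_nonneg c_le_1 by blast+
    moreover have "0 \<le> d (k + 3) * x (k + 4)" "d (k + 3) * x (k + 4) \<le> x (k + 4)"
      using gb(3) d_pos[of "k + 3"] d_le_1[of "k + 3"] by (auto intro: mult_left_le_one_le)
    moreover have "x (k + 6) = c (k + 3) * - x (k + 5) - d (k + 3) * x (k + 4)"
      using frac_step[of "k + 3"] by (simp add: numeral_eq_Suc)
    ultimately show ?thesis using gb(3) x5 by linarith
  qed
  then have "height (k + 4) \<le> 6 * e"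
    using x4' x5 gb(3) gap(2) x2 by (simp add: height_def add.commute)
  then show False using e by (simp add: w_def)
qed

lemma middle_le_height_drop:
  assumes "long_gap k"
  shows "\<bar>x (k + 2)\<bar> \<le> height k - height (k + 3)"
proof (cases "0 < x (k + 2)")
  case True
  then show ?thesis using middle_le_height_drop_aux[OF assms] by simp
next
  case False
  then have "x (k + 2) < 0" using assms by (auto simp: long_gap_def zero_less_mult_iff)
  then show ?thesis using assms
      residual_recurrence.middle_le_height_drop_aux[OF uminus_residual_recurrence, of k]
    by (simp add: height_uminus long_gap_uminus)
qed

lemma height_contracts:
  assumes "long_gap k" "x (k + 4) \<noteq> 0"
  shows "7 * height (k + 4) \<le> 6 * height k"
proof (cases "0 < x (k + 2)")
  case True
  then show ?thesis using height_contracts_aux assms by simp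
next
  case False
  then have "x (k + 2) < 0" using assms by (auto simp: long_gap_def zero_less_mult_iff)
  then show ?thesis using assms
      residual_recurrence.height_contracts_aux[OF uminus_residual_recurrence, of k]
    by (simp add: height_uminus long_gap_uminus)
qed

lemma height_convergent: obtains L where "height \<longlonglongrightarrow> L"
  using decseq_convergent[of height 0] antimono_height height_nonneg by blast

lemma long_gap_frequently_small_middle:
  assumes gaps: "\<exists>\<^sub>\<infinity>k. long_gap k" and "0 < \<delta>"
  shows "\<exists>k. x (k + 2) \<noteq> 0 \<and> \<bar>x (k + 2)\<bar> < \<delta>"
proof -
  obtain L where L: "height \<longlonglongrightarrow> L" by (rule height_convergent)
  have "(\<lambda>k. height k - height (k + 3)) \<longlonglongrightarrow> L - L"
    by (intro tendsto_diff L LIMSEQ_ignore_initial_segment)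
  then have "\<forall>\<^sub>\<infinity>k. height k - height (k + 3) < \<delta>"
    using order_tendstoD(2)[of _ 0 _ \<delta>] \<open>0 < \<delta>\<close> by (simp add: cofinite_eq_sequentially)
  with gaps have "\<exists>\<^sub>\<infinity>k. long_gap k \<and> height k - height (k + 3) < \<delta>"
    by (rule frequently_eventually_frequently)
  then obtain k where k: "long_gap k" "height k - height (k + 3) < \<delta>"
    using frequently_ex by blast
  then have "x (k + 2) \<noteq> 0" by (auto simp: long_gap_def)
  then show ?thesis using k middle_le_height_drop[OF k(1)] by force
qed

lemma tendsto_0_if_frequently_long_gap:
  assumes gaps: "\<exists>\<^sub>\<infinity>k. long_gap k" and nonzero: "\<And>n. x n \<noteq> 0"
  shows "x \<longlonglongrightarrow> 0"
proof -
  obtain L where L: "height \<longlonglongrightarrow> L" by (rule height_convergent)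
  have L_le: "L \<le> height n" for n
    using decseq_ge[OF _ L] antimono_height by blast
  have "7 * L \<le> 6 * L"
  proof (rule ccontr)
    assume "\<not> ?thesis"
    then have "L < 7 / 6 * L" by simp
    then have "\<forall>\<^sub>\<infinity>k. height k < 7 / 6 * L"
      using order_tendstoD(2)[OF L, of "7 / 6 * L"] unfolding cofinite_eq_sequentially by blast
    with gaps have "\<exists>\<^sub>\<infinity>k. long_gap k \<and> height k < 7 / 6 * L"
      by (rule frequently_eventually_frequently)
    then obtain k where k: "long_gap k" "height k < 7 / 6 * L"
      using frequently_ex by blast
    show False
      using height_contracts[OF k(1) nonzero] L_le[of "k + 4"] k(2) by simp
  qed
  moreover have "0 \<le> L" using LIMSEQ_le_const[OF L] height_nonneg by blast
  ultimately have "height \<longlonglongrightarrow> 0" using L by simp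
  then have "(\<lambda>n. \<bar>x n\<bar>) \<longlonglongrightarrow> 0"
    by (rule tendsto_sandwich[rotated -1, where f = "\<lambda>_. 0"]) (simp_all add: height_bounds)
  then show ?thesis by (rule tendsto_rabs_zero_cancel)
qed

end

section \<open>The two recurrences of the Jacobi-Perron residuals\<close>

lemma jp_Suc:
  "jp_alpha \<alpha>0 \<beta>0 (Suc n) = frac (jp_beta \<alpha>0 \<beta>0 n) / frac (jp_alpha \<alpha>0 \<beta>0 n)"
  "jp_beta \<alpha>0 \<beta>0 (Suc n) = 1 / frac (jp_alpha \<alpha>0 \<beta>0 n)"
  by (simp_all add: jp_alpha_def jp_beta_def)

lemma jp_reaches_antimono: "jp_reaches \<alpha>0 \<beta>0 n \<Longrightarrow> m \<le> n \<Longrightarrow> jp_reaches \<alpha>0 \<beta>0 m"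
  by (auto simp: jp_reaches_def)

lemma jp_rec_ge_0:
  assumes "\<And>n. 0 \<le> a n" "\<And>n. 0 \<le> b n"
  shows "0 \<le> jp_rec a b 0 0 1 n"
  using assms by (induction a b "0::int" "0::int" "1::int" n rule: jp_rec.induct) auto

lemma jp_rec_ge_1:
  assumes "\<And>n. 0 \<le> a n" "\<And>n. 1 \<le> b n"
  shows "1 \<le> jp_rec a b 0 0 1 (n + 2)"
proof (induction n)
  case (Suc n)
  have b0: "0 \<le> b n" for n using assms(2)[of n] by linarith
  have nonneg: "0 \<le> jp_rec a b 0 0 1 k" for k
    by (rule jp_rec_ge_0) (use assms(1) b0 in auto)
  have "1 * 1 \<le> jp_rec a b 0 0 1 (n + 2) * b (Suc n)"
    using Suc.IH assms(2) by (intro mult_mono) auto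
  moreover have "0 \<le> jp_rec a b 0 0 1 (Suc n) * a (Suc n)"
    using nonneg assms(1) by simp
  ultimately show ?case using nonneg[of n] by simp
qed simp

locale infinite_jp_expansion =
  fixes \<alpha>0 \<beta>0 :: real
  assumes initial: "0 \<le> \<alpha>0" "\<alpha>0 \<le> \<beta>0" "1 \<le> \<beta>0"
    and reaches: "jp_reaches \<alpha>0 \<beta>0 n"
begin

lemma frac_alpha_pos: "0 < frac (jp_alpha \<alpha>0 \<beta>0 n)"
  using reaches[of "Suc n"] frac_ge_0[of "jp_alpha \<alpha>0 \<beta>0 n"]
  unfolding jp_reaches_def by (metis lessI order_le_less)

lemma alpha_beta_bounds:
  "0 \<le> jp_alpha \<alpha>0 \<beta>0 n" "jp_alpha \<alpha>0 \<beta>0 n \<le> jp_beta \<alpha>0 \<beta>0 n" "1 \<le> jp_beta \<alpha>0 \<beta>0 n"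
proof -
  have "0 \<le> jp_alpha \<alpha>0 \<beta>0 n \<and> jp_alpha \<alpha>0 \<beta>0 n \<le> jp_beta \<alpha>0 \<beta>0 n \<and> 1 \<le> jp_beta \<alpha>0 \<beta>0 n"
  proof (cases n)
    case 0
    then show ?thesis using initial by (simp add: jp_alpha_def jp_beta_def)
  next
    case (Suc m)
    then show ?thesis
      using frac_alpha_pos[of m] frac_lt_1[of "jp_alpha \<alpha>0 \<beta>0 m"]
        frac_lt_1[of "jp_beta \<alpha>0 \<beta>0 m"] frac_ge_0[of "jp_beta \<alpha>0 \<beta>0 m"]
      by (simp add: jp_Suc divide_right_mono)
  qed
  then show "0 \<le> jp_alpha \<alpha>0 \<beta>0 n" "jp_alpha \<alpha>0 \<beta>0 n \<le> jp_beta \<alpha>0 \<beta>0 n" "1 \<le> jp_beta \<alpha>0 \<beta>0 n"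
    by auto
qed

lemma digit_bounds:
  "0 \<le> jp_a \<alpha>0 \<beta>0 n" "jp_a \<alpha>0 \<beta>0 n \<le> jp_b \<alpha>0 \<beta>0 n" "1 \<le> jp_b \<alpha>0 \<beta>0 n"
  using alpha_beta_bounds[of n] by (auto simp: jp_a_def jp_b_def intro: floor_mono)

text \<open>The residuals with the index shifted by two, so that the initial values \<open>\<Delta>\<^sub>-\<^sub>2 = 1\<close> and
  \<open>\<Delta>\<^sub>-\<^sub>1 = 0\<close> are included.\<close>

definition shifted_Delta :: "nat \<Rightarrow> real" where
  "shifted_Delta k =
     of_int (jp_rec (jp_a \<alpha>0 \<beta>0) (jp_b \<alpha>0 \<beta>0) 1 0 (jp_a \<alpha>0 \<beta>0 0) k)
     - \<alpha>0 * of_int (jp_rec (jp_a \<alpha>0 \<beta>0) (jp_b \<alpha>0 \<beta>0) 0 0 1 k)"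

lemma jp_Delta_eq_shifted: "jp_Delta \<alpha>0 \<beta>0 n = shifted_Delta (n + 2)"
  by (simp add: jp_Delta_def jp_p_def jp_r_def shifted_Delta_def)

lemma shifted_Delta_digit_step:
  "shifted_Delta (k + 3) = jp_b \<alpha>0 \<beta>0 (k + 1) * shifted_Delta (k + 2)
     + jp_a \<alpha>0 \<beta>0 (k + 1) * shifted_Delta (k + 1) + shifted_Delta k"
  by (simp add: shifted_Delta_def numeral_eq_Suc algebra_simps)

text \<open>Three consecutive vectors \<open>(p, q, r)\<close>, latest first, combined with the coefficients
  \<open>\<beta>, \<alpha>, 1\<close> give a multiple of \<open>(\<alpha>\<^sub>0, \<beta>\<^sub>0, 1)\<close>, where the linear form \<open>p - \<alpha>\<^sub>0 r\<close>
  vanishes.\<close>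

lemma shifted_Delta_exact:
  "jp_beta \<alpha>0 \<beta>0 (k + 1) * shifted_Delta (k + 2)
     + jp_alpha \<alpha>0 \<beta>0 (k + 1) * shifted_Delta (k + 1) + shifted_Delta k = 0"
proof (induction k)
  case 0
  have "shifted_Delta 2 = - frac \<alpha>0" "shifted_Delta 1 = 0" "shifted_Delta 0 = 1"
    by (simp_all add: shifted_Delta_def numeral_eq_Suc jp_a_def jp_alpha_def frac_def)
  then show ?case
    using frac_alpha_pos[of 0] by (simp add: jp_Suc jp_alpha_def numeral_eq_Suc)
next
  case (Suc k)
  let ?f = "frac (jp_alpha \<alpha>0 \<beta>0 (k + 1))" and ?g = "frac (jp_beta \<alpha>0 \<beta>0 (k + 1))"
  have f: "?f \<noteq> 0" using frac_alpha_pos[of "k + 1"] by linarith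
  have "shifted_Delta (k + 3) = - (?g * shifted_Delta (k + 2)) - ?f * shifted_Delta (k + 1)"
    using Suc.IH shifted_Delta_digit_step[of k]
    by (simp add: frac_def jp_a_def jp_b_def algebra_simps)
  then have "1 / ?f * shifted_Delta (k + 3) + ?g / ?f * shifted_Delta (k + 2)
      + shifted_Delta (k + 1) = 0"
    using f by (simp add: field_simps)
  then show ?case
    using jp_Suc[of \<alpha>0 \<beta>0 "k + 1"] by (simp add: numeral_eq_Suc)
qed

lemma shifted_Delta_frac_step:
  "shifted_Delta (k + 3) = - (frac (jp_beta \<alpha>0 \<beta>0 (k + 1)) * shifted_Delta (k + 2))
     - frac (jp_alpha \<alpha>0 \<beta>0 (k + 1)) * shifted_Delta (k + 1)"
  using shifted_Delta_exact[of k] shifted_Delta_digit_step[of k]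
  by (simp add: frac_def jp_a_def jp_b_def algebra_simps)

sublocale residual_recurrence "jp_Delta \<alpha>0 \<beta>0"
  "\<lambda>n. jp_a \<alpha>0 \<beta>0 (n + 3)" "\<lambda>n. jp_b \<alpha>0 \<beta>0 (n + 3)"
  "\<lambda>n. frac (jp_beta \<alpha>0 \<beta>0 (n + 3))" "\<lambda>n. frac (jp_alpha \<alpha>0 \<beta>0 (n + 3))"
proof
  fix n
  show "jp_Delta \<alpha>0 \<beta>0 (n + 3) = jp_b \<alpha>0 \<beta>0 (n + 3) * jp_Delta \<alpha>0 \<beta>0 (n + 2)
      + jp_a \<alpha>0 \<beta>0 (n + 3) * jp_Delta \<alpha>0 \<beta>0 (n + 1) + jp_Delta \<alpha>0 \<beta>0 n"
    using shifted_Delta_digit_step[of "n + 2"]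
    by (simp add: jp_Delta_eq_shifted numeral_eq_Suc)
  show "jp_Delta \<alpha>0 \<beta>0 (n + 3) = - (frac (jp_beta \<alpha>0 \<beta>0 (n + 3)) * jp_Delta \<alpha>0 \<beta>0 (n + 2))
      - frac (jp_alpha \<alpha>0 \<beta>0 (n + 3)) * jp_Delta \<alpha>0 \<beta>0 (n + 1)"
    using shifted_Delta_frac_step[of "n + 2"]
    by (simp add: jp_Delta_eq_shifted numeral_eq_Suc)
qed (use digit_bounds frac_alpha_pos frac_lt_1 in \<open>auto intro: order.strict_implies_order[OF frac_lt_1]\<close>)

text \<open>If \<open>\<Delta>\<^sub>k = 0\<close>, then \<open>\<alpha>\<^sub>0 = p\<^sub>k / r\<^sub>k\<close> and every \<open>r\<^sub>k \<Delta>\<^sub>n\<close> is an integer.\<close>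

lemma Delta_discrete_if_zero:
  assumes "jp_Delta \<alpha>0 \<beta>0 k = 0"
  obtains \<delta> where "0 < \<delta>" "\<And>n. jp_Delta \<alpha>0 \<beta>0 n \<noteq> 0 \<Longrightarrow> \<delta> \<le> \<bar>jp_Delta \<alpha>0 \<beta>0 n\<bar>"
proof
  let ?r = "jp_r \<alpha>0 \<beta>0" and ?p = "jp_p \<alpha>0 \<beta>0"
  have r: "0 < ?r k"
    using jp_rec_ge_1[of "jp_a \<alpha>0 \<beta>0" "jp_b \<alpha>0 \<beta>0" k] digit_bounds by (simp add: jp_r_def)
  then show "0 < 1 / real_of_int (?r k)" by simp
  fix n assume nz: "jp_Delta \<alpha>0 \<beta>0 n \<noteq> 0"
  have pk: "of_int (?p k) = \<alpha>0 * of_int (?r k)" using assms by (simp add: jp_Delta_def)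
  have eq: "of_int (?p n * ?r k - ?p k * ?r n) = jp_Delta \<alpha>0 \<beta>0 n * of_int (?r k)"
    by (simp add: pk jp_Delta_def algebra_simps)
  with nz r have "?p n * ?r k - ?p k * ?r n \<noteq> 0" by (metis mult_eq_0_iff of_int_0 of_int_0_eq_iff
      order_less_irrefl)
  then have "1 \<le> \<bar>?p n * ?r k - ?p k * ?r n\<bar>" by linarith
  then have "1 \<le> \<bar>real_of_int (?p n * ?r k - ?p k * ?r n)\<bar>" by linarith
  then have "1 \<le> \<bar>jp_Delta \<alpha>0 \<beta>0 n\<bar> * of_int (?r k)" unfolding eq using r by (simp add: abs_mult)
  then show "1 / of_int (?r k) \<le> \<bar>jp_Delta \<alpha>0 \<beta>0 n\<bar>" using r by (simp add: field_simps)
qed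

lemma Delta_tendsto_0_if_frequently_long_gap:
  assumes gaps: "\<exists>\<^sub>\<infinity>k. long_gap k"
  shows "jp_Delta \<alpha>0 \<beta>0 \<longlonglongrightarrow> 0"
proof (rule tendsto_0_if_frequently_long_gap[OF gaps])
  show "jp_Delta \<alpha>0 \<beta>0 n \<noteq> 0" for n
  proof
    assume "jp_Delta \<alpha>0 \<beta>0 n = 0"
    then obtain \<delta> where "0 < \<delta>"
      and \<delta>: "\<And>n. jp_Delta \<alpha>0 \<beta>0 n \<noteq> 0 \<Longrightarrow> \<delta> \<le> \<bar>jp_Delta \<alpha>0 \<beta>0 n\<bar>"
      using Delta_discrete_if_zero by blast
    from long_gap_frequently_small_middle[OF gaps \<open>0 < \<delta>\<close>] \<delta> show False by force
  qed
qed

end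

section \<open>Gaps in the set of same-sign indices\<close>

lemma not_in_between_enumerate:
  fixes S :: "nat set"
  assumes "infinite S" "enumerate S i < n" "n < enumerate S (Suc i)"
  shows "n \<notin> S"
  using assms not_less_Least by (force simp: enumerate_Suc'')

theorem theorem2p1:
  fixes \<alpha>0 \<beta>0 :: real
  assumes "0 \<le> \<alpha>0" and "\<alpha>0 \<le> \<beta>0" and "1 \<le> \<beta>0"
    and "infinite (same_sign_indices \<alpha>0 \<beta>0)"
    and "infinite {i. enumerate (same_sign_indices \<alpha>0 \<beta>0) i + 4
                        \<le> enumerate (same_sign_indices \<alpha>0 \<beta>0) (Suc i)}"
  shows "jp_Delta \<alpha>0 \<beta>0 \<longlonglongrightarrow> 0"
proof -
  let ?S = "same_sign_indices \<alpha>0 \<beta>0"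
  have reaches: "jp_reaches \<alpha>0 \<beta>0 n" for n
  proof -
    obtain m where "n \<le> m" "m \<in> ?S"
      using assms(4) unfolding infinite_nat_iff_unbounded_le by blast
    then show ?thesis using jp_reaches_antimono by (auto simp: same_sign_indices_def)
  qed
  interpret infinite_jp_expansion \<alpha>0 \<beta>0
    by standard (use assms reaches in auto)
  have S_iff: "Suc n \<in> ?S \<longleftrightarrow> jp_Delta \<alpha>0 \<beta>0 n * jp_Delta \<alpha>0 \<beta>0 (Suc n) > 0" for n
    using reaches by (simp add: same_sign_indices_def)
  have "\<exists>k\<ge>N. long_gap k" for N
  proof -
    obtain i where i: "N + 2 \<le> i" "enumerate ?S i + 4 \<le> enumerate ?S (Suc i)"
      using assms(5) unfolding infinite_nat_iff_unbounded_le by blast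
    define k where "k = enumerate ?S i - 2"
    have k: "N \<le> k" "enumerate ?S i = k + 2"
      using i le_enumerate[OF assms(4), of i] by (auto simp: k_def)
    have "k + 2 \<in> ?S" using enumerate_in_set[OF assms(4), of i] k by simp
    moreover have "k + 4 \<notin> ?S" "k + 5 \<notin> ?S"
      using not_in_between_enumerate[OF assms(4), of i] i k by auto
    ultimately have "long_gap k"
      using S_iff[of "k + 1"] S_iff[of "k + 3"] S_iff[of "k + 4"]
      by (simp add: long_gap_def numeral_eq_Suc not_less)
    with k show ?thesis by blast
  qed
  then have "\<exists>\<^sub>\<infinity>k. long_gap k" by (simp add: INFM_nat_le)
  then show ?thesis by (rule Delta_tendsto_0_if_frequently_long_gap)
qed

end
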